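(* Let $\Gamma$ be a simply-laced Dynkin diagram, let $\Lambda\subset(\mathbb{Z}\Gamma)_0$ be a finite set and let $\theta\colon\Lambda\sqcup(\{-\infty\}\times\Gamma_0)\to\mathbb{Z}$ be a function such that $(\Lambda,\theta)$ satisfies mesh relations. Suppose that $\theta$ is non-negative on $\Lambda$ and vanishes on precisely one vertex of $\Lambda$, that $\theta(-\infty,i)=-1$ for some $i\in\Gamma_0$, and that $\theta(-\infty,k)=0$ for all $k\in\Gamma_0\setminus\{i\}$. Then $\gamma_\Lambda$ is left-divisible in $B_\Gamma^+$ by some generator $s_j$ with $j\neq i$.
   Context: $\Gamma_0$ is the vertex set of $\Gamma$ and $N(j)$ the set of neighbours of $j$. Assume $\Gamma$ has at least two vertices. $\Gamma_0=V^0\sqcup V^1$ is a bipartition such that each edge has one endpoint in $V^0$ and the other in $V^1$; the upper index of $V^n$, $n\in\mathbb{Z}$, is taken modulo $2$. $B_\Gamma^+$ is the monoid generated by $s_i$, $i\in\Gamma_0$, with relations $s_is_js_i=s_js_is_j$ for $i,j$ adjacent and $s_is_j=s_js_i$ for $i,j$ not adjacent; $\gamma$ is left-divisible by $s_j$ if $\gamma=s_j\gamma'$ for some $\gamma'\in B_\Gamma^+$. $\mathbb{Z}\Gamma$ is the directed graph with vertex set $(\mathbb{Z}\Gamma)_0=\{(n,j)\mid n\in\mathbb{Z},\ j\in V^n\}$ and an arrow $(n,j)\to(n+1,i)$ for every edge $(i,j)$ of $\Gamma$. Put $p_1(n,j)=n$, $p_2(n,j)=j$. For a finite set $\Lambda\subset(\mathbb{Z}\Gamma)_0$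 let $\Sigma_k=\{j\in V^k\mid(k,j)\in\Lambda\}$, $s_{\Sigma_k}=\prod_{j\in\Sigma_k}s_j$ (these generators commute pairwise; $s_\varnothing=1$), and $\gamma_\Lambda=\prod_{k=-\infty}^{+\infty}s_{\Sigma_k}\in B_\Gamma^+$, the product taken from left to right in increasing order of $k$. For $b\in\Lambda$ with $p_2(b)=t$: if there is $a\in\Lambda$ with $p_2(a)=t$, $p_1(a)<p_1(b)$ and $(k,t)\notin\Lambda$ for all $p_1(a)<k<p_1(b)$, put $\tau_\Lambda(b)=a$ and $mesh_\Lambda(\tau_\Lambda(b),b)=\{c\in\Lambda\mid p_2(c)\in N(t),\ p_1(a)<p_1(c)<p_1(b)\}$. If there is no such $a$, put $\tau_\Lambda(b)=(-\infty,t)$ (an "imaginary" vertex) and $mesh_\Lambda(\tau_\Lambda(b),b)=\{c\in\Lambda\mid p_2(c)\in N(t),\ p_1(c)<p_1(b)\}$. $(\Lambda,\theta)$ satisfies mesh relations if for every $b\in\Lambda$ one has $\theta(b)+\theta(\tau_\Lambda(b))=\sum_{c\in mesh_\Lambda(\tau_\Lambda(b),b)}\theta(c)$. *)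

theory Defs
  imports "HOL-Algebra.Divisibility" "HOL-Library.Extended"
begin

text \<open>A simple graph is given by its vertex set \<open>V\<close> and its set \<open>E\<close> of edges, an edge
  being a two-element subset of \<open>V\<close>. The connected simply-laced Dynkin diagrams are listed
  on the vertex set \<open>{1..n}\<close>, where \<open>n\<close> is the rank.\<close>

definition path_edges :: "nat \<Rightarrow> nat set set" where
  "path_edges n = {{k, k + 1} | k. 1 \<le> k \<and> k < n}"

text \<open>In type D the last vertex is attached to the last but one vertex of the path
  \<open>1 - \<dots> - (n - 1)\<close>; in type E it is attached to the third vertex of that path.\<close>

inductive ADE_diagram :: "nat \<Rightarrow> nat set set \<Rightarrow> bool" where
  type_A: "n \<ge> 1 \<Longrightarrow> ADE_diagram n (path_edges n)"
| type_D: "n \<ge> 4 \<Longrightarrow> ADE_diagram n (insert {n - 2, n} (path_edges (n - 1)))"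
| type_E: "n \<in> {6, 7, 8} \<Longrightarrow> ADE_diagram n (insert {3, n} (path_edges (n - 1)))"

definition simply_laced_Dynkin :: "'a set \<Rightarrow> 'a set set \<Rightarrow> bool" where
  "simply_laced_Dynkin V E \<longleftrightarrow>
     (\<exists>n D f. ADE_diagram n D \<and> bij_betw f {1..n} V \<and> E = (\<lambda>e. f ` e) ` D)"

definition neighbours :: "'a set set \<Rightarrow> 'a \<Rightarrow> 'a set" where
  "neighbours E j = {i. {i, j} \<in> E}"

definition bipartition :: "'a set \<Rightarrow> 'a set set \<Rightarrow> 'a set \<Rightarrow> 'a set \<Rightarrow> bool" where
  "bipartition V E V0 V1 \<longleftrightarrow>
     V0 \<union> V1 = V \<and> V0 \<inter> V1 = {} \<and> (\<forall>e\<in>E. \<exists>x\<in>V0. \<exists>y\<in>V1. e = {x, y})"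

definition part :: "'a set \<Rightarrow> 'a set \<Rightarrow> int \<Rightarrow> 'a set" where
  "part V0 V1 n = (if even n then V0 else V1)"


text \<open>The positive braid monoid is the quotient of the free monoid of words in \<open>V\<close> by the
  congruence generated by the braid relations. Its elements are congruence classes of words.\<close>

inductive_set braid_cong :: "'a set \<Rightarrow> 'a set set \<Rightarrow> ('a list \<times> 'a list) set"
  for V :: "'a set" and E :: "'a set set" where
  refl: "xs \<in> lists V \<Longrightarrow> (xs, xs) \<in> braid_cong V E"
| sym: "(xs, ys) \<in> braid_cong V E \<Longrightarrow> (ys, xs) \<in> braid_cong V E"
| trans: "(xs, ys) \<in> braid_cong V E \<Longrightarrow> (ys, zs) \<in> braid_cong V E \<Longrightarrow> (xs, zs) \<in> braid_cong V E"
| braid: "i \<in> V \<Longrightarrow> j \<in> V \<Longrightarrow> {i, j} \<in> E \<Longrightarrow> us \<in> lists V \<Longrightarrow> vs \<in> lists V \<Longrightarrow>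
    (us @ [i, j, i] @ vs, us @ [j, i, j] @ vs) \<in> braid_cong V E"
| comm: "i \<in> V \<Longrightarrow> j \<in> V \<Longrightarrow> {i, j} \<notin> E \<Longrightarrow> us \<in> lists V \<Longrightarrow> vs \<in> lists V \<Longrightarrow>
    (us @ [i, j] @ vs, us @ [j, i] @ vs) \<in> braid_cong V E"

definition braid_monoid :: "'a set \<Rightarrow> 'a set set \<Rightarrow> 'a list set monoid" where
  "braid_monoid V E =
     \<lparr>carrier = lists V // braid_cong V E,
      mult = (\<lambda>A B. \<Union>x\<in>A. \<Union>y\<in>B. braid_cong V E `` {x @ y}),
      one = braid_cong V E `` {[]}\<rparr>"

definition braid_gen :: "'a set \<Rightarrow> 'a set set \<Rightarrow> 'a \<Rightarrow> 'a list set" where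
  "braid_gen V E j = braid_cong V E `` {[j]}"

definition list_product :: "('b, 'c) monoid_scheme \<Rightarrow> 'b list \<Rightarrow> 'b" where
  "list_product G xs = foldr (mult G) xs (one G)"

text \<open>The generators indexed by \<open>S\<close> are multiplied in an arbitrarily chosen order. The result
  does not depend on it if they commute pairwise: see \<open>gen_product_eq\<close> below.\<close>

definition gen_product :: "'a set \<Rightarrow> 'a set set \<Rightarrow> 'a set \<Rightarrow> 'a list set" where
  "gen_product V E S = list_product (braid_monoid V E)
     (map (braid_gen V E) (SOME xs. distinct xs \<and> set xs = S))"

lemma braid_cong_lists:
  "(xs, ys) \<in> braid_cong V E \<Longrightarrow> xs \<in> lists V \<and> ys \<in> lists V"
  by (induction rule: braid_cong.induct) auto

lemma equiv_braid_cong: "equiv (lists V) (braid_cong V E)"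
proof (rule equivI)
  show "braid_cong V E \<subseteq> lists V \<times> lists V"
    using braid_cong_lists by fast
  show "refl_on (lists V) (braid_cong V E)"
    by (rule refl_onI) (rule braid_cong.refl)
  show "sym (braid_cong V E)"
    by (rule symI) (rule braid_cong.sym)
  show "trans (braid_cong V E)"
    by (rule transI) (rule braid_cong.trans)
qed

lemma braid_cong_context:
  assumes "(xs, ys) \<in> braid_cong V E" "us \<in> lists V" "vs \<in> lists V"
  shows "(us @ xs @ vs, us @ ys @ vs) \<in> braid_cong V E"
  using assms
proof (induction rule: braid_cong.induct)
  case (refl xs)
  then show ?case by (intro braid_cong.refl) auto
next
  case (sym xs ys)
  then show ?case by (blast intro: braid_cong.sym)
next
  case (trans xs ys zs)
  then show ?case by (blast intro: braid_cong.trans)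
next
  case (braid i j ps qs)
  then show ?case
    using braid_cong.braid[of i V j E "us @ ps" "qs @ vs"] by simp
next
  case (comm i j ps qs)
  then show ?case
    using braid_cong.comm[of i V j E "us @ ps" "qs @ vs"] by simp
qed

lemma braid_cong_append:
  assumes "(xs, xs') \<in> braid_cong V E" "(ys, ys') \<in> braid_cong V E"
  shows "(xs @ ys, xs' @ ys') \<in> braid_cong V E"
  using braid_cong_context[OF assms(1), of "[]" ys] braid_cong_context[OF assms(2), of xs' "[]"]
    braid_cong_lists[OF assms(1)] braid_cong_lists[OF assms(2)]
  by (auto intro: braid_cong.trans)

lemma braid_mult_class:
  assumes "xs \<in> lists V" "ys \<in> lists V"
  shows "braid_cong V E `` {xs} \<otimes>\<^bsub>braid_monoid V E\<^esub> braid_cong V E `` {ys} =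
    braid_cong V E `` {xs @ ys}"
proof -
  have "braid_cong V E `` {x @ y} = braid_cong V E `` {xs @ ys}"
    if "(xs, x) \<in> braid_cong V E" "(ys, y) \<in> braid_cong V E" for x y
    using equiv_class_eq[OF equiv_braid_cong braid_cong_append[OF that]] by simp
  then have "(\<Union>x\<in>braid_cong V E `` {xs}. \<Union>y\<in>braid_cong V E `` {ys}. braid_cong V E `` {x @ y}) =
    (\<Union>x\<in>braid_cong V E `` {xs}. \<Union>y\<in>braid_cong V E `` {ys}. braid_cong V E `` {xs @ ys})"
    by (intro SUP_cong) auto
  also have "\<dots> = braid_cong V E `` {xs @ ys}"
    using braid_cong.refl[OF assms(1), of E] braid_cong.refl[OF assms(2), of E] by blast
  finally show ?thesis
    by (simp add: braid_monoid_def)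
qed

lemma braid_carrierE:
  assumes "A \<in> carrier (braid_monoid V E)"
  obtains xs where "xs \<in> lists V" "A = braid_cong V E `` {xs}"
  using assms that unfolding braid_monoid_def quotient_def by auto

lemma braid_class_carrier:
  "xs \<in> lists V \<Longrightarrow> braid_cong V E `` {xs} \<in> carrier (braid_monoid V E)"
  by (simp add: braid_monoid_def quotientI)

lemma braid_one: "\<one>\<^bsub>braid_monoid V E\<^esub> = braid_cong V E `` {[]}"
  by (simp add: braid_monoid_def)

lemma monoid_braid_monoid: "monoid (braid_monoid V E)"
proof (rule monoidI)
  fix A B assume "A \<in> carrier (braid_monoid V E)" "B \<in> carrier (braid_monoid V E)"
  then show "A \<otimes>\<^bsub>braid_monoid V E\<^esub> B \<in> carrier (braid_monoid V E)"
    by (elim braid_carrierE) (simp add: braid_mult_class braid_class_carrier)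
next
  show "\<one>\<^bsub>braid_monoid V E\<^esub> \<in> carrier (braid_monoid V E)"
    by (simp add: braid_one braid_class_carrier)
next
  fix A B C
  assume "A \<in> carrier (braid_monoid V E)" "B \<in> carrier (braid_monoid V E)"
    "C \<in> carrier (braid_monoid V E)"
  then show "A \<otimes>\<^bsub>braid_monoid V E\<^esub> B \<otimes>\<^bsub>braid_monoid V E\<^esub> C =
    A \<otimes>\<^bsub>braid_monoid V E\<^esub> (B \<otimes>\<^bsub>braid_monoid V E\<^esub> C)"
    by (elim braid_carrierE) (simp add: braid_mult_class)
next
  fix A assume "A \<in> carrier (braid_monoid V E)"
  then show "\<one>\<^bsub>braid_monoid V E\<^esub> \<otimes>\<^bsub>braid_monoid V E\<^esub> A = A"
    by (elim braid_carrierE) (simp add: braid_one braid_mult_class)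
next
  fix A assume "A \<in> carrier (braid_monoid V E)"
  then show "A \<otimes>\<^bsub>braid_monoid V E\<^esub> \<one>\<^bsub>braid_monoid V E\<^esub> = A"
    by (elim braid_carrierE) (simp add: braid_one braid_mult_class)
qed

lemma list_product_gens:
  "xs \<in> lists V \<Longrightarrow>
     list_product (braid_monoid V E) (map (braid_gen V E) xs) = braid_cong V E `` {xs}"
  by (induction xs) (auto simp: list_product_def braid_one braid_gen_def braid_mult_class)

lemma braid_cong_move_front:
  assumes "set us \<subseteq> V" "x \<in> V" "\<And>u. u \<in> set us \<Longrightarrow> {x, u} \<notin> E"
  shows "(x # us, us @ [x]) \<in> braid_cong V E"
  using assms
proof (induction us)
  case Nil
  then show ?case by (simp add: braid_cong.refl)
next
  case (Cons u us)
  have "u \<in> V" "us \<in> lists V" "{x, u} \<notin> E"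
    using Cons.prems by auto
  then have "(x # u # us, u # x # us) \<in> braid_cong V E"
    using braid_cong.comm[of x V u E "[]" us] Cons.prems(2) by simp
  moreover have "(u # x # us, u # us @ [x]) \<in> braid_cong V E"
    using braid_cong_context[of "x # us" "us @ [x]" V E "[u]" "[]"] Cons by simp
  ultimately show ?case
    by (auto intro: braid_cong.trans)
qed

lemma braid_cong_enumerations:
  assumes "distinct xs" "distinct ys" "set xs = set ys" "set xs \<subseteq> V"
    "\<And>i j. i \<in> set xs \<Longrightarrow> j \<in> set xs \<Longrightarrow> {i, j} \<notin> E"
  shows "(xs, ys) \<in> braid_cong V E"
  using assms
proof (induction xs arbitrary: ys)
  case Nil
  then show ?case by (simp add: braid_cong.refl)
next
  case (Cons x xs)
  then obtain us vs where ys: "ys = us @ x # vs"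
    by (metis list.set_intros(1) split_list)
  have "set xs = set (x # xs) - {x}" "set (us @ vs) = set ys - {x}"
    using Cons.prems(1,2) ys by auto
  then have set: "set xs = set (us @ vs)"
    using Cons.prems(3) by (metis list.simps(15))
  have "(xs, us @ vs) \<in> braid_cong V E"
    by (rule Cons.IH) (use Cons.prems ys set in auto)
  then have "(x # xs, x # us @ vs) \<in> braid_cong V E"
    using braid_cong_context[of xs "us @ vs" V E "[x]" "[]"] Cons.prems(4) by simp
  moreover have "(x # us, us @ [x]) \<in> braid_cong V E"
    by (rule braid_cong_move_front) (use Cons.prems ys in auto)
  then have "(x # us @ vs, us @ x # vs) \<in> braid_cong V E"
    using braid_cong_context[of "x # us" "us @ [x]" V E "[]" vs] Cons.prems set by auto
  ultimately show ?case
    using ys by (auto intro: braid_cong.trans)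
qed

lemma gen_product_eq:
  assumes "distinct xs" "set xs = S" "S \<subseteq> V" "\<And>i j. i \<in> S \<Longrightarrow> j \<in> S \<Longrightarrow> {i, j} \<notin> E"
  shows "gen_product V E S = list_product (braid_monoid V E) (map (braid_gen V E) xs)"
proof -
  define ys where "ys = (SOME ys. distinct ys \<and> set ys = S)"
  have ys: "distinct ys \<and> set ys = S"
    unfolding ys_def by (rule someI[of _ xs]) (use assms in simp)
  have "(ys, xs) \<in> braid_cong V E"
    by (rule braid_cong_enumerations) (use assms ys in auto)
  then have "braid_cong V E `` {ys} = braid_cong V E `` {xs}"
    by (rule equiv_class_eq[OF equiv_braid_cong])
  moreover have "ys \<in> lists V" "xs \<in> lists V"
    using assms ys by auto
  ultimately show ?thesis
    unfolding gen_product_def ys_def[symmetric] by (simp add: list_product_gens)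
qed


definition ZGamma_vertices :: "'a set \<Rightarrow> 'a set \<Rightarrow> (int \<times> 'a) set" where
  "ZGamma_vertices V0 V1 = {(n, j). j \<in> part V0 V1 n}"

definition level :: "'a set \<Rightarrow> 'a set \<Rightarrow> (int \<times> 'a) set \<Rightarrow> int \<Rightarrow> 'a set" where
  "level V0 V1 \<Lambda> k = {j \<in> part V0 V1 k. (k, j) \<in> \<Lambda>}"

text \<open>In the product over all integers \<open>k\<close>, only the factors with \<open>k \<in> fst ` \<Lambda>\<close> can differ
  from the unit.\<close>

definition gamma :: "'a set \<Rightarrow> 'a set set \<Rightarrow> 'a set \<Rightarrow> 'a set \<Rightarrow> (int \<times> 'a) set \<Rightarrow> 'a list set" where
  "gamma V E V0 V1 \<Lambda> = list_product (braid_monoid V E)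
     (map (\<lambda>k. gen_product V E (level V0 V1 \<Lambda> k)) (sorted_list_of_set (fst ` \<Lambda>)))"


text \<open>Functions on the disjoint union of \<open>\<Lambda>\<close> and the imaginary vertices are functions on
  \<open>int extended \<times> 'a\<close>: the vertex \<open>(n, j)\<close> is \<open>(Fin n, j)\<close>, the imaginary vertex of \<open>j\<close> is
  \<open>(Minf, j)\<close>, and the values elsewhere are irrelevant.\<close>

definition vertex :: "int \<times> 'a \<Rightarrow> int extended \<times> 'a" where
  "vertex a = (Fin (fst a), snd a)"

definition is_pred :: "(int \<times> 'a) set \<Rightarrow> int \<times> 'a \<Rightarrow> int \<times> 'a \<Rightarrow> bool" where
  "is_pred \<Lambda> b a \<longleftrightarrow> a \<in> \<Lambda> \<and> snd a = snd b \<and> fst a < fst b \<and>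
     (\<forall>k. fst a < k \<and> k < fst b \<longrightarrow> (k, snd b) \<notin> \<Lambda>)"

definition tau :: "(int \<times> 'a) set \<Rightarrow> int \<times> 'a \<Rightarrow> int extended \<times> 'a" where
  "tau \<Lambda> b = (if \<exists>a. is_pred \<Lambda> b a then vertex (THE a. is_pred \<Lambda> b a) else (Minf, snd b))"

lemma is_pred_unique:
  assumes "is_pred \<Lambda> b a" "is_pred \<Lambda> b a'"
  shows "a = a'"
proof -
  have "fst a = fst a'"
    using assms unfolding is_pred_def by (metis linorder_neqE prod.collapse)
  with assms show ?thesis
    by (auto simp: is_pred_def prod_eq_iff)
qed

lemma tau_is_pred: "is_pred \<Lambda> b a \<Longrightarrow> tau \<Lambda> b = vertex a"
  unfolding tau_def using is_pred_unique[of \<Lambda> b] by (metis the_equality)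

text \<open>Since \<open>Minf < Fin n\<close> for all \<open>n\<close>, this also covers the case of an imaginary \<open>a\<close>.\<close>

definition mesh :: "'a set set \<Rightarrow> (int \<times> 'a) set \<Rightarrow> int extended \<times> 'a \<Rightarrow> int \<times> 'a \<Rightarrow> (int \<times> 'a) set" where
  "mesh E \<Lambda> a b =
     {c \<in> \<Lambda>. snd c \<in> neighbours E (snd b) \<and> fst a < Fin (fst c) \<and> fst c < fst b}"

definition satisfies_mesh_relations ::
    "'a set set \<Rightarrow> (int \<times> 'a) set \<Rightarrow> (int extended \<times> 'a \<Rightarrow> int) \<Rightarrow> bool" where
  "satisfies_mesh_relations E \<Lambda> \<theta> \<longleftrightarrow>
     (\<forall>b\<in>\<Lambda>. \<theta> (vertex b) + \<theta> (tau \<Lambda> b) = (\<Sum>c\<in>mesh E \<Lambda> (tau \<Lambda> b) b. \<theta> (vertex c)))"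

end

theory Submission
  imports Defs
begin

text \<open>
  The function \<open>\<theta>\<close> records values of a weight that is being reflected. Write a weight in the
  coordinates given by the fundamental weights, so that it is an integer function \<open>u\<close> on the
  vertices of \<open>\<Gamma>\<close>; the simple reflection at \<open>t\<close> negates \<open>u t\<close> and adds the old value of \<open>u t\<close> to
  the coordinates of the neighbours of \<open>t\<close>. Start from the fundamental weight of \<open>i\<close>, that is from
  \<open>u t = - \<theta> (-\<infinity>, t)\<close>, and apply the reflections at the letters of a word for \<open>\<gamma>\<^sub>\<Lambda>\<close>, read from
  left to right. The mesh relations say exactly that \<open>\<theta>\<close> at an element \<open>(n, t)\<close> of \<open>\<Lambda>\<close> is the
  \<open>t\<close>-coordinate just before the corresponding letter \<open>t\<close> is applied
  (\<open>mesh_weight_prefix\<close>). So \<open>\<theta>\<close> is positive at the letters up to a first zero.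

  It remains to bring this letter \<open>j\<close> to the front by braid relations. The values read off
  along a word are only permuted by braid relations, and the final weight does not change
  (\<open>braid_cong_invariants\<close>). Consider a word along which all values are positive, starting
  from a dominant weight. If the final weight has a negative \<open>j\<close>-coordinate, then the word
  is equivalent to one that ends with \<open>j\<close> (\<open>negative_letter_moves_to_end\<close>); this replaces the
  exchange condition and Matsumoto's theorem. If the final weight vanishes at \<open>j\<close>, let \<open>k\<close> be
  the last letter of the word. Either \<open>k\<close> and \<open>j\<close> commute and the zero moves one step to the
  left, or the weight before \<open>k\<close> is negative at \<open>j\<close>, hence the word can be rewritten to end with
  \<open>j k\<close>; followed by \<open>j\<close> it ends with \<open>j k j = k j k\<close>, and the zero is now at the first letter \<open>k\<close>
  of these three (\<open>zero_letter_moves_to_front\<close>). In the end the zero stands at the first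
  letter \<open>l\<close>, where its value is the \<open>l\<close>-coordinate of the initial weight. Since the initial
  \<open>i\<close>-coordinate is \<open>1\<close>, this letter is not \<open>i\<close>.
\<close>

section \<open>Reflecting a weight along a word\<close>

definition reflect :: "'a set set \<Rightarrow> 'a \<Rightarrow> ('a \<Rightarrow> int) \<Rightarrow> 'a \<Rightarrow> int" where
  "reflect E t u = (\<lambda>j. if j = t then - u t else if {j, t} \<in> E then u j + u t else u j)"

abbreviation weight_after :: "'a set set \<Rightarrow> ('a \<Rightarrow> int) \<Rightarrow> 'a list \<Rightarrow> 'a \<Rightarrow> int" where
  "weight_after E u ws \<equiv> fold (reflect E) ws u"

text \<open>In terms of roots, the values tested here are the pairings of the initial weight with
  the roots \<open>s\<^sub>1 \<dots> s\<^sub>m\<^sub>-\<^sub>1 \<alpha>\<^sub>m\<close>, which are the inversions of the word if it is reduced.\<close>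

primrec positive_word :: "'a set set \<Rightarrow> ('a \<Rightarrow> int) \<Rightarrow> 'a list \<Rightarrow> bool" where
  "positive_word E u [] \<longleftrightarrow> True"
| "positive_word E u (t # ws) \<longleftrightarrow> u t > 0 \<and> positive_word E (reflect E t u) ws"

lemma positive_word_append:
  "positive_word E u (us @ vs) \<longleftrightarrow>
     positive_word E u us \<and> positive_word E (weight_after E u us) vs"
  by (induction us arbitrary: u) auto

lemma reflect_braid:
  assumes "\<And>x. {x} \<notin> E" "{i, j} \<in> E"
  shows "weight_after E u [i, j, i] = weight_after E u [j, i, j]"
    and "positive_word E u [i, j, i] \<longleftrightarrow> positive_word E u [j, i, j]"
proof -
  have "i \<noteq> j" "{j, i} \<in> E"
    using assms by (auto simp: insert_commute)
  then show "weight_after E u [i, j, i] = weight_after E u [j, i, j]"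
    "positive_word E u [i, j, i] \<longleftrightarrow> positive_word E u [j, i, j]"
    using assms(2) by (auto simp: reflect_def fun_eq_iff)
qed

lemma reflect_comm:
  assumes "{i, j} \<notin> E"
  shows "weight_after E u [i, j] = weight_after E u [j, i]"
    and "positive_word E u [i, j] \<longleftrightarrow> positive_word E u [j, i]"
proof -
  have "{j, i} \<notin> E"
    using assms by (simp add: insert_commute)
  then show "weight_after E u [i, j] = weight_after E u [j, i]"
    "positive_word E u [i, j] \<longleftrightarrow> positive_word E u [j, i]"
    using assms by (auto simp: reflect_def fun_eq_iff)
qed

text \<open>In a dihedral piece \<open>i j i\<close> the values read off are \<open>u i\<close>, \<open>u i + u j\<close>, \<open>u j\<close>, so that \<open>j i j\<close>
  gives the same values in reverse order; in a commuting piece two values are swapped.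
  Without loops, the braid relations only involve distinct letters.\<close>

lemma braid_cong_invariants:
  assumes "(xs, ys) \<in> braid_cong V E" "\<And>x. {x} \<notin> E"
  shows "weight_after E u xs = weight_after E u ys \<and>
    (positive_word E u xs \<longleftrightarrow> positive_word E u ys) \<and> length xs = length ys"
  using assms(1)
proof (induction arbitrary: u rule: braid_cong.induct)
  case (braid i j us vs)
  note eq = reflect_braid[OF assms(2) \<open>{i, j} \<in> E\<close>]
  have "weight_after E u (us @ [i, j, i] @ vs) = weight_after E u (us @ [j, i, j] @ vs)"
    unfolding fold_append comp_apply eq(1) ..
  moreover have "positive_word E u (us @ [i, j, i] @ vs) \<longleftrightarrow>
      positive_word E u (us @ [j, i, j] @ vs)"
    unfolding positive_word_append eq ..
  ultimately show ?case by simp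
next
  case (comm i j us vs)
  note eq = reflect_comm[OF \<open>{i, j} \<notin> E\<close>]
  have "weight_after E u (us @ [i, j] @ vs) = weight_after E u (us @ [j, i] @ vs)"
    unfolding fold_append comp_apply eq(1) ..
  moreover have "positive_word E u (us @ [i, j] @ vs) \<longleftrightarrow>
      positive_word E u (us @ [j, i] @ vs)"
    unfolding positive_word_append eq ..
  ultimately show ?case by simp
qed auto

lemma braid_cong_braid_end:
  assumes "v \<in> lists V" "j \<in> V" "k \<in> V" "{j, k} \<in> E"
  shows "(v @ [j, k, j], v @ [k, j, k]) \<in> braid_cong V E"
  using braid_cong.braid[of j V k E v "[]"] assms by simp

lemma braid_cong_comm_end:
  assumes "v \<in> lists V" "j \<in> V" "k \<in> V" "{j, k} \<notin> E"
  shows "(v @ [j, k], v @ [k, j]) \<in> braid_cong V E"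
  using braid_cong.comm[of j V k E v "[]"] assms by simp

lemma braid_cong_append_right:
  assumes "(v, w) \<in> braid_cong V E" "xs \<in> lists V"
  shows "(v @ xs, w @ xs) \<in> braid_cong V E"
  using braid_cong_append[OF assms(1) braid_cong.refl[OF assms(2)]] .


section \<open>Moving letters in positive words\<close>

text \<open>Induction on the length. Let \<open>k \<noteq> j\<close> be the last letter and \<open>y\<close> the weight before it, so
  \<open>y k > 0\<close>. If \<open>j\<close> and \<open>k\<close> are adjacent, then \<open>y j + y k < 0\<close>, so \<open>y j < 0\<close> and the rest of the
  word can be made to end with \<open>j\<close>. Before that \<open>j\<close> the weight has \<open>k\<close>-coordinate \<open>y j + y k < 0\<close>,
  so that a further \<open>k\<close> can be moved there and the word ends with \<open>k j k = j k j\<close>.\<close>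

lemma negative_letter_moves_to_end:
  assumes loopfree: "\<And>x. {x} \<notin> E" and dominant: "\<And>x. x \<in> V \<Longrightarrow> u x \<ge> 0"
    and "w \<in> lists V" "positive_word E u w" "j \<in> V" "weight_after E u w j < 0"
  shows "\<exists>v. (w, v @ [j]) \<in> braid_cong V E"
  using assms(3-6)
proof (induction "length w" arbitrary: w j rule: less_induct)
  case less
  show ?case
  proof (cases w rule: rev_cases)
    case Nil
    with less.prems dominant[of j] show ?thesis by simp
  next
    case (snoc v k)
    let ?y = "weight_after E u v"
    have v: "v \<in> lists V" "k \<in> V" "positive_word E u v" "?y k > 0" "length v < length w"
      using less.prems snoc by (auto simp: positive_word_append)
    have w_j: "reflect E k ?y j < 0"
      using less.prems(4) snoc by simp
    consider "k = j" | "k \<noteq> j" "{j, k} \<notin> E" | "k \<noteq> j" "{j, k} \<in> E" by blast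
    then show ?thesis
    proof cases
      case 1
      then show ?thesis
        using snoc braid_cong.refl[OF less.prems(1)] by auto
    next
      case 2
      then have "?y j < 0"
        using w_j by (simp add: reflect_def)
      then obtain v' where v': "(v, v' @ [j]) \<in> braid_cong V E"
        using less.hyps[of v j] v less.prems by blast
      have "(w, v' @ [j, k]) \<in> braid_cong V E"
        using braid_cong_append_right[OF v', of "[k]"] v(2) snoc by simp
      moreover have "(v' @ [j, k], v' @ [k, j]) \<in> braid_cong V E"
        using braid_cong_lists[OF v'] v(2) 2 by (intro braid_cong_comm_end) auto
      ultimately have "(w, (v' @ [k]) @ [j]) \<in> braid_cong V E"
        by (auto intro: braid_cong.trans)
      then show ?thesis by blast
    next
      case 3
      then have kj: "?y j + ?y k < 0"
        using w_j by (simp add: reflect_def)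
      then obtain v' where v': "(v, v' @ [j]) \<in> braid_cong V E"
        using less.hyps[of v j] v less.prems by fastforce
      let ?z = "weight_after E u v'"
      note inv = braid_cong_invariants[OF v' loopfree, of u]
      have y_eq: "?y = reflect E j ?z"
        using inv by simp
      have pos: "positive_word E u v'"
        using inv v(3) by (simp add: positive_word_append)
      have "?z k < 0"
        using kj 3 unfolding y_eq by (simp add: reflect_def insert_commute)
      then obtain v'' where v'': "(v', v'' @ [k]) \<in> braid_cong V E"
        using less.hyps[of v' k] v pos inv braid_cong_lists[OF v'] by auto
      have "(w, v' @ [j, k]) \<in> braid_cong V E"
        using braid_cong_append_right[OF v', of "[k]"] v(2) snoc by simp
      moreover have "(v' @ [j, k], v'' @ [k, j, k]) \<in> braid_cong V E"
        using braid_cong_append_right[OF v'', of "[j, k]"] v(2) less.prems(3) by simp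
      moreover have "(v'' @ [k, j, k], v'' @ [j, k, j]) \<in> braid_cong V E"
        using braid_cong_lists[OF v''] v(2) less.prems(3) 3
        by (intro braid_cong_braid_end) (auto simp: insert_commute)
      ultimately have "(w, (v'' @ [j, k]) @ [j]) \<in> braid_cong V E"
        by (auto intro: braid_cong.trans)
      then show ?thesis by blast
    qed
  qed
qed

text \<open>The letter that carries the value zero changes under braid relations: in \<open>j k j = k j k\<close> a
  zero at the last \<open>j\<close> becomes a zero at the first \<open>k\<close>. So the letter \<open>l\<close> that arrives at the front
  need not be \<open>j\<close>, but it still carries the value zero, now taken in the initial weight.\<close>

lemma zero_letter_moves_to_front:
  assumes loopfree: "\<And>x. {x} \<notin> E" and dominant: "\<And>x. x \<in> V \<Longrightarrow> u x \<ge> 0"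
    and "w \<in> lists V" "positive_word E u w" "j \<in> V" "weight_after E u w j = 0"
  shows "\<exists>l w'. u l = 0 \<and> (w @ [j], l # w') \<in> braid_cong V E"
  using assms(3-6)
proof (induction "length w" arbitrary: w j rule: less_induct)
  case less
  show ?case
  proof (cases w rule: rev_cases)
    case Nil
    then have "u j = 0 \<and> (w @ [j], j # []) \<in> braid_cong V E"
      using less.prems by (simp add: braid_cong.refl)
    then show ?thesis by blast
  next
    case (snoc v k)
    let ?y = "weight_after E u v"
    have v: "v \<in> lists V" "k \<in> V" "positive_word E u v" "?y k > 0" "length v < length w"
      using less.prems snoc by (auto simp: positive_word_append)
    have w_j: "reflect E k ?y j = 0"
      using less.prems(4) snoc by simp
    have "k \<noteq> j"
      using w_j v(4) by (auto simp: reflect_def)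
    show ?thesis
    proof (cases "{j, k} \<in> E")
      case False
      then have "?y j = 0"
        using w_j \<open>k \<noteq> j\<close> by (simp add: reflect_def)
      then obtain l w' where l: "u l = 0" "(v @ [j], l # w') \<in> braid_cong V E"
        using less.hyps[of v j] v less.prems by blast
      have "(w @ [j], v @ [j, k]) \<in> braid_cong V E"
        using braid_cong_comm_end[of v V k j E] v less.prems(3) snoc False
        by (simp add: insert_commute)
      moreover have "(v @ [j, k], l # w' @ [k]) \<in> braid_cong V E"
        using braid_cong_append_right[OF l(2), of "[k]"] v(2) by simp
      ultimately show ?thesis
        using l(1) by (blast intro: braid_cong.trans)
    next
      case True
      then have kj: "?y j + ?y k = 0"
        using w_j \<open>k \<noteq> j\<close> by (simp add: reflect_def)
      then have "?y j < 0"
        using v(4) by simp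
      then obtain v' where v': "(v, v' @ [j]) \<in> braid_cong V E"
        using negative_letter_moves_to_end[OF loopfree dominant v(1,3) less.prems(3)] by blast
      let ?z = "weight_after E u v'"
      note inv = braid_cong_invariants[OF v' loopfree, of u]
      have y_eq: "?y = reflect E j ?z"
        using inv by simp
      have pos: "positive_word E u v'"
        using inv v(3) by (simp add: positive_word_append)
      have "?z k = 0"
        using kj True \<open>k \<noteq> j\<close> unfolding y_eq by (simp add: reflect_def insert_commute)
      then obtain l w' where l: "u l = 0" "(v' @ [k], l # w') \<in> braid_cong V E"
        using less.hyps[of v' k] v pos inv braid_cong_lists[OF v'] by auto
      have "(w @ [j], v' @ [j, k, j]) \<in> braid_cong V E"
        using braid_cong_append_right[OF v', of "[k, j]"] v(2) less.prems(3) snoc by simp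
      moreover have "(v' @ [j, k, j], v' @ [k, j, k]) \<in> braid_cong V E"
        using braid_cong_lists[OF v'] v(2) less.prems(3) True
        by (intro braid_cong_braid_end) auto
      moreover have "(v' @ [k, j, k], l # w' @ [j, k]) \<in> braid_cong V E"
        using braid_cong_append_right[OF l(2), of "[j, k]"] v(2) less.prems(3) by simp
      ultimately show ?thesis
        using l(1) by (blast intro: braid_cong.trans)
    qed
  qed
qed


section \<open>The mesh relations compute the reflected weights\<close>

definition last_level :: "(int \<times> 'a) set \<Rightarrow> 'a \<Rightarrow> int extended" where
  "last_level P t = Max (insert Minf (Fin ` {k. (k, t) \<in> P}))"

text \<open>This is what the mesh relation predicts for \<open>\<theta>\<close> at the next vertex over \<open>t\<close>, given that
  the vertices in \<open>P\<close> have been passed: the sum over the mesh that is open at present minus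
  the value at its left end, which is imaginary if \<open>P\<close> has no vertex over \<open>t\<close>.\<close>

definition mesh_weight ::
    "'a set set \<Rightarrow> (int \<times> 'a) set \<Rightarrow> (int extended \<times> 'a \<Rightarrow> int) \<Rightarrow> 'a \<Rightarrow> int" where
  "mesh_weight E P \<theta> t = - \<theta> (last_level P t, t) +
     (\<Sum>c | c \<in> P \<and> {snd c, t} \<in> E \<and> last_level P t < Fin (fst c). \<theta> (vertex c))"

lemma finite_column: "finite P \<Longrightarrow> finite {k. (k, t) \<in> P}"
  by (rule finite_subset[of _ "fst ` P"]) force+

lemma tau_eq_last_level:
  assumes "finite P" "{k. (k, snd b) \<in> P} = {k. (k, snd b) \<in> \<Lambda> \<and> k < fst b}"
  shows "tau \<Lambda> b = (last_level P (snd b), snd b)"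
proof (cases "{k. (k, snd b) \<in> P} = {}")
  case True
  then have "\<not> is_pred \<Lambda> b a" for a
    using assms(2) unfolding is_pred_def by (metis (mono_tags, lifting) empty_Collect_eq prod.collapse)
  with True show ?thesis
    by (simp add: tau_def last_level_def)
next
  case False
  let ?K = "{k. (k, snd b) \<in> P}"
  have fin: "finite ?K"
    by (rule finite_column[OF assms(1)])
  have "Max ?K \<in> ?K"
    using Max_in[OF fin False] .
  then have "is_pred \<Lambda> b (Max ?K, snd b)"
    using assms(2) Max_ge[OF fin] unfolding is_pred_def by fastforce
  moreover have "last_level P (snd b) = Fin (Max ?K)"
    unfolding last_level_def
    by (rule Max_eqI) (use fin \<open>Max ?K \<in> ?K\<close> Max_ge[OF fin] in auto)
  ultimately show ?thesis
    using tau_is_pred by (fastforce simp: vertex_def)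
qed

text \<open>Passing a vertex \<open>b\<close> over \<open>t\<close> closes the mesh at \<open>t\<close>, and the new one starts empty with left
  end \<open>b\<close>, whence the sign change; the open mesh at each neighbour of \<open>t\<close> acquires \<open>b\<close>. Vertices
  on the same level are not adjacent, so the order in which a level is passed does not
  affect the strict inequalities that define the meshes.\<close>

lemma mesh_weight_next:
  assumes "finite \<Lambda>" "P \<subseteq> \<Lambda>" "b \<in> \<Lambda>" "b \<notin> P"
    and before: "\<And>c. c \<in> P \<Longrightarrow> fst c \<le> fst b" "\<And>c. c \<in> \<Lambda> \<Longrightarrow> fst c < fst b \<Longrightarrow> c \<in> P"
    and same_level: "\<And>c d. c \<in> \<Lambda> \<Longrightarrow> d \<in> \<Lambda> \<Longrightarrow> fst c = fst d \<Longrightarrow> {snd c, snd d} \<notin> E"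
    and "satisfies_mesh_relations E \<Lambda> \<theta>"
  shows "mesh_weight E P \<theta> (snd b) = \<theta> (vertex b)"
    and "mesh_weight E (insert b P) \<theta> = reflect E (snd b) (mesh_weight E P \<theta>)"
proof -
  obtain n t where b: "b = (n, t)" by (cases b)
  have fin: "finite P"
    using assms(1,2) finite_subset by blast
  have "(k, t) \<in> P \<longleftrightarrow> (k, t) \<in> \<Lambda> \<and> k < n" for k
    using before(1)[of "(k, t)"] before(2)[of "(k, t)"] assms(2,4) b by (cases "k = n") auto
  then have column: "{k. (k, t) \<in> P} = {k. (k, t) \<in> \<Lambda> \<and> k < n}"
    by simp
  have tau: "tau \<Lambda> b = (last_level P t, t)"
    using tau_eq_last_level[OF fin, of b \<Lambda>] column b by simp
  have adjacent: "fst c < n" if "c \<in> P" "{snd c, t} \<in> E" for c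
    using before(1)[OF that(1)] same_level[of c b] that assms(2,3) b by (cases "fst c = n") auto
  \<comment> \<open>Neighbours in \<open>P\<close> lie strictly to the left of \<open>b\<close>, so the open mesh at \<open>t\<close> is the mesh that ends at \<open>b\<close>.\<close>
  have "mesh E \<Lambda> (tau \<Lambda> b) b =
      {c. c \<in> P \<and> {snd c, t} \<in> E \<and> last_level P t < Fin (fst c)}"
    unfolding mesh_def neighbours_def tau using adjacent before(2) assms(2) b by auto
  then show val: "mesh_weight E P \<theta> (snd b) = \<theta> (vertex b)"
    using bspec[OF assms(8)[unfolded satisfies_mesh_relations_def] assms(3)] tau b
    unfolding mesh_weight_def by simp
  show "mesh_weight E (insert b P) \<theta> = reflect E (snd b) (mesh_weight E P \<theta>)"
  proof
    fix j
    show "mesh_weight E (insert b P) \<theta> j = reflect E (snd b) (mesh_weight E P \<theta>) j"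
    proof (cases "j = t")
      case True
      have last: "last_level (insert b P) t = Fin n"
        unfolding last_level_def
      proof (rule Max_eqI)
        show "finite (insert Minf (Fin ` {k. (k, t) \<in> insert b P}))"
          using finite_column[of "insert b P" t] fin by simp
        show "y \<le> Fin n" if "y \<in> insert Minf (Fin ` {k. (k, t) \<in> insert b P})" for y
          using that before(1) b by fastforce
      qed (use b in simp)
      have none: "{c. c \<in> insert b P \<and> {snd c, t} \<in> E \<and> Fin n < Fin (fst c)} = {}"
        using before(1) b by force
      have "mesh_weight E (insert b P) \<theta> t = - \<theta> (vertex b)"
        unfolding mesh_weight_def last none by (simp add: vertex_def b)
      then show ?thesis
        using True val b by (simp add: reflect_def)
    next
      case False
      have lvl: "last_level (insert b P) j = last_level P j"
        using False b by (simp add: last_level_def)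
      let ?C = "{c. c \<in> P \<and> {snd c, j} \<in> E \<and> last_level P j < Fin (fst c)}"
      have finC: "finite ?C" "b \<notin> ?C"
        using fin assms(4) by auto
      show ?thesis
      proof (cases "{j, t} \<in> E")
        case True
        have "last_level P j < Fin n"
        proof -
          have "k < n" if "(k, j) \<in> P" for k
            using adjacent[of "(k, j)"] that True by simp
          then show ?thesis
            unfolding last_level_def using finite_column[OF fin] by (subst Max_less_iff) auto
        qed
        then have "{c. c \<in> insert b P \<and> {snd c, j} \<in> E \<and> last_level P j < Fin (fst c)} = insert b ?C"
          using True b by (auto simp: insert_commute)
        then have "mesh_weight E (insert b P) \<theta> j = mesh_weight E P \<theta> j + \<theta> (vertex b)"
          unfolding mesh_weight_def lvl using finC by simp
        then show ?thesis
          using True False val b by (simp add: reflect_def)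
      next
        case nonadjacent: False
        then have "{c. c \<in> insert b P \<and> {snd c, j} \<in> E \<and> last_level P j < Fin (fst c)} = ?C"
          using b by (auto simp: insert_commute)
        then show ?thesis
          using False nonadjacent b unfolding mesh_weight_def lvl by (simp add: reflect_def)
      qed
    qed
  qed
qed

lemma mesh_weight_prefix:
  assumes "finite \<Lambda>" "sorted (map fst bs)" "distinct bs" "set bs = \<Lambda>"
    and same_level: "\<And>c d. c \<in> \<Lambda> \<Longrightarrow> d \<in> \<Lambda> \<Longrightarrow> fst c = fst d \<Longrightarrow> {snd c, snd d} \<notin> E"
    and "satisfies_mesh_relations E \<Lambda> \<theta>"
    and "bs = ps @ b # qs"
  shows "weight_after E (\<lambda>t. - \<theta> (Minf, t)) (map snd ps) (snd b) = \<theta> (vertex b)"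
proof -
  let ?u = "\<lambda>t. - \<theta> (Minf, t)"
  have step: "mesh_weight E (set ps) \<theta> (snd b) = \<theta> (vertex b)"
    "mesh_weight E (insert b (set ps)) \<theta> = reflect E (snd b) (mesh_weight E (set ps) \<theta>)"
    if "bs = ps @ b # qs" for ps b qs
  proof -
    have "set ps \<subseteq> \<Lambda>" "b \<in> \<Lambda>" "b \<notin> set ps"
      using assms(3,4) that by auto
    moreover have "fst c \<le> fst b" if "c \<in> set ps" for c
      using assms(2) \<open>bs = ps @ b # qs\<close> that by (auto simp: sorted_append)
    moreover have "c \<in> set ps" if "c \<in> \<Lambda>" "fst c < fst b" for c
      using assms(2,4) \<open>bs = ps @ b # qs\<close> that by (auto simp: sorted_append)
    ultimately show "mesh_weight E (set ps) \<theta> (snd b) = \<theta> (vertex b)"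
      "mesh_weight E (insert b (set ps)) \<theta> = reflect E (snd b) (mesh_weight E (set ps) \<theta>)"
      using mesh_weight_next[OF assms(1) _ _ _ _ _ same_level assms(6), of "set ps" b] by blast+
  qed
  have "weight_after E ?u (map snd ps) = mesh_weight E (set ps) \<theta>"
    using assms(7)
  proof (induction ps arbitrary: b qs rule: rev_induct)
    case Nil
    then show ?case by (simp add: mesh_weight_def last_level_def)
  next
    case (snoc p ps)
    then have "bs = ps @ p # b # qs" by simp
    from snoc.IH[OF this] step(2)[OF this] show ?case by simp
  qed
  then show ?thesis
    using step(1)[OF assms(7)] by simp
qed


section \<open>Words representing \<open>\<gamma>\<^sub>\<Lambda>\<close>\<close>

lemma list_product_classes:
  assumes "\<And>k. k \<in> set ks \<Longrightarrow> f k \<in> lists V"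
  shows "list_product (braid_monoid V E) (map (\<lambda>k. braid_cong V E `` {f k}) ks) =
    braid_cong V E `` {concat (map f ks)}"
  using assms
proof (induction ks)
  case Nil
  then show ?case by (simp add: list_product_def braid_one)
next
  case (Cons k ks)
  have "concat (map f ks) \<in> lists V"
    using Cons.prems by force
  with Cons show ?case
    by (simp add: list_product_def braid_mult_class)
qed

lemma level_enumeration:
  assumes "sorted_wrt (<) (ks :: int list)" "\<And>k. k \<in> set ks \<Longrightarrow> distinct (f k)"
  shows "sorted (map fst (concat (map (\<lambda>k. map (Pair k) (f k)) ks))) \<and>
    distinct (concat (map (\<lambda>k. map (Pair k) (f k)) ks))"
  using assms
proof (induction ks)
  case (Cons k ks)
  let ?bs = "concat (map (\<lambda>k. map (Pair k) (f k)) ks)"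
  have later: "k < fst b" if "b \<in> set ?bs" for b
    using Cons.prems(1) that by auto
  have "sorted (map fst (map (Pair k) (f k)))"
    by (simp add: comp_def map_replicate_const)
  then have "sorted (map fst (map (Pair k) (f k) @ ?bs))"
    unfolding map_append sorted_append using Cons less_imp_le[OF later] by auto
  moreover have "distinct (map (Pair k) (f k) @ ?bs)"
    unfolding distinct_append using Cons later by (auto simp: distinct_map inj_on_def)
  ultimately show ?case by simp
qed simp

lemma gamma_enumeration:
  assumes "finite \<Lambda>" "\<Lambda> \<subseteq> ZGamma_vertices V0 V1" "V0 \<union> V1 = V"
  obtains bs where "sorted (map fst bs)" "distinct bs" "set bs = \<Lambda>"
    "gamma V E V0 V1 \<Lambda> = braid_cong V E `` {map snd bs}"
proof -
  define f where "f k = (SOME xs. distinct xs \<and> set xs = level V0 V1 \<Lambda> k)" for k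
  define ks where "ks = sorted_list_of_set (fst ` \<Lambda>)"
  define bs where "bs = concat (map (\<lambda>k. map (Pair k) (f k)) ks)"
  have "finite (level V0 V1 \<Lambda> k)" for k
    by (rule finite_subset[of _ "snd ` \<Lambda>"]) (use assms(1) in \<open>force simp: level_def\<close>)+
  then have "\<exists>xs. distinct xs \<and> set xs = level V0 V1 \<Lambda> k" for k
    using finite_distinct_list by blast
  then have f: "distinct (f k)" "set (f k) = level V0 V1 \<Lambda> k" for k
    unfolding f_def by (metis (mono_tags, lifting) someI_ex)+
  have f_V: "f k \<in> lists V" for k
    using f(2)[of k] assms(3) by (auto simp: level_def part_def split: if_splits)
  have ks: "sorted_wrt (<) ks" "set ks = fst ` \<Lambda>"
    using assms(1) by (auto simp: ks_def)
  have "set bs = \<Lambda>"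
    using assms(2) by (force simp: bs_def ks(2) f(2) level_def ZGamma_vertices_def)
  moreover have "gamma V E V0 V1 \<Lambda> = braid_cong V E `` {map snd bs}"
  proof -
    have "gen_product V E (level V0 V1 \<Lambda> k) = braid_cong V E `` {f k}" for k
      unfolding gen_product_def f_def[symmetric] by (rule list_product_gens[OF f_V])
    then have "gamma V E V0 V1 \<Lambda> = braid_cong V E `` {concat (map f ks)}"
      unfolding gamma_def ks_def[symmetric] by (simp add: list_product_classes f_V)
    moreover have "map snd bs = concat (map f ks)"
      by (simp add: bs_def map_concat comp_def)
    ultimately show ?thesis by simp
  qed
  moreover have "sorted (map fst bs)" "distinct bs"
    using level_enumeration[OF ks(1) f(1)] by (simp_all only: bs_def)
  ultimately show ?thesis
    using that by blast
qed


section \<open>Left-divisibility\<close>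

theorem theorem3:
  fixes V V0 V1 :: "'a set" and E :: "'a set set"
    and \<Lambda> :: "(int \<times> 'a) set" and \<theta> :: "int extended \<times> 'a \<Rightarrow> int" and i :: 'a
  assumes "simply_laced_Dynkin V E"
    and "card V \<ge> 2"
    and "bipartition V E V0 V1"
    and "finite \<Lambda>"
    and "\<Lambda> \<subseteq> ZGamma_vertices V0 V1"
    and "satisfies_mesh_relations E \<Lambda> \<theta>"
    and "\<forall>b\<in>\<Lambda>. \<theta> (vertex b) \<ge> 0"
    and "\<exists>!b. b \<in> \<Lambda> \<and> \<theta> (vertex b) = 0"
    and "i \<in> V"
    and "\<theta> (Minf, i) = -1"
    and "\<forall>k\<in>V - {i}. \<theta> (Minf, k) = 0"
  shows "\<exists>j\<in>V. j \<noteq> i \<and> braid_gen V E j divides\<^bsub>braid_monoid V E\<^esub> gamma V E V0 V1 \<Lambda>"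
proof -
  let ?u = "\<lambda>t. - \<theta> (Minf, t)"
  have V: "V0 \<union> V1 = V" and disj: "V0 \<inter> V1 = {}"
    using assms(3)[unfolded bipartition_def] by (rule conjunct1, rule conjunct1[OF conjunct2])
  have edge: "x \<in> V0 \<longleftrightarrow> y \<notin> V0" if "{x, y} \<in> E" for x y
  proof -
    obtain x' y' where "x' \<in> V0" "y' \<in> V1" "{x, y} = {x', y'}"
      using assms(3) \<open>{x, y} \<in> E\<close> unfolding bipartition_def by meson
    then show ?thesis
      using disj by (auto simp: doubleton_eq_iff)
  qed
  have loopfree: "{x} \<notin> E" for x
    using edge[of x x] by auto
  have \<Lambda>_part: "snd c \<in> part V0 V1 (fst c)" if "c \<in> \<Lambda>" for c
    using that assms(5) by (auto simp: ZGamma_vertices_def)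
  have same_level: "{snd c, snd d} \<notin> E" if "c \<in> \<Lambda>" "d \<in> \<Lambda>" "fst c = fst d" for c d
    using \<Lambda>_part[OF that(1)] \<Lambda>_part[OF that(2)] that(3) edge[of "snd c" "snd d"] disj
    by (auto simp: part_def split: if_splits)
  obtain bs where bs: "sorted (map fst bs)" "distinct bs" "set bs = \<Lambda>"
    and gamma: "gamma V E V0 V1 \<Lambda> = braid_cong V E `` {map snd bs}"
    using gamma_enumeration[OF assms(4,5) V] by blast
  have bs_V: "map snd bs \<in> lists V"
  proof -
    have "snd c \<in> V" if "c \<in> \<Lambda>" for c
      using \<Lambda>_part[OF that] V by (auto simp: part_def split: if_splits)
    then show ?thesis
      using bs(3) by auto
  qed
  have weight: "weight_after E ?u (map snd ps) (snd b) = \<theta> (vertex b)"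
    if "bs = ps @ b # qs" for ps b qs
    by (rule mesh_weight_prefix[OF assms(4) bs same_level assms(6) that])
  \<comment> \<open>Take the first zero of \<open>\<theta>\<close>, so that all values before it are positive.\<close>
  obtain ps b qs where split: "bs = ps @ b # qs" "\<theta> (vertex b) = 0"
    and first: "\<forall>p\<in>set ps. \<theta> (vertex p) \<noteq> 0"
  proof -
    have "\<exists>b\<in>set bs. \<theta> (vertex b) = 0"
      using assms(8) bs(3) by blast
    then show ?thesis
      using that by (auto elim!: split_list_first_propE)
  qed
  have "positive_word E ?u (map snd ps')" if "ps = ps' @ ps''" for ps' ps''
    using that
  proof (induction ps' arbitrary: ps'' rule: rev_induct)
    case (snoc p ps')
    have "p \<in> set ps" "set ps \<subseteq> \<Lambda>"
      using snoc.prems split(1) bs(3) by auto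
    then have "\<theta> (vertex p) > 0"
      using first assms(7) by (metis order_le_less subsetD)
    moreover have "weight_after E ?u (map snd ps') (snd p) = \<theta> (vertex p)"
      by (rule weight[of ps' p "ps'' @ b # qs"]) (use snoc.prems split(1) in simp)
    ultimately show ?case
      using snoc by (simp add: positive_word_append)
  qed simp
  then have "positive_word E ?u (map snd ps)" by simp
  moreover have "weight_after E ?u (map snd ps) (snd b) = 0"
    using weight[OF split(1)] split(2) by simp
  moreover have "?u x \<ge> 0" if "x \<in> V" for x
    using that assms(10,11) by (cases "x = i") auto
  ultimately obtain l w where l: "\<theta> (Minf, l) = 0"
    and w: "(map snd ps @ [snd b], l # w) \<in> braid_cong V E"
    using zero_letter_moves_to_front[of E V ?u "map snd ps" "snd b", OF loopfree] bs_V split(1)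
    by fastforce
  have word: "(map snd bs, l # w @ map snd qs) \<in> braid_cong V E"
    using braid_cong_append_right[OF w, of "map snd qs"] bs_V split(1) by simp
  then have "l \<in> V" "w @ map snd qs \<in> lists V"
    using braid_cong_lists[OF word] by simp_all
  moreover have "gamma V E V0 V1 \<Lambda> = braid_gen V E l \<otimes>\<^bsub>braid_monoid V E\<^esub>
      braid_cong V E `` {w @ map snd qs}"
    using calculation equiv_class_eq[OF equiv_braid_cong word] gamma
    by (simp add: braid_gen_def braid_mult_class)
  ultimately have "braid_gen V E l divides\<^bsub>braid_monoid V E\<^esub> gamma V E V0 V1 \<Lambda>"
    by (intro dividesI[of "braid_cong V E `` {w @ map snd qs}"] braid_class_carrier)
  moreover have "l \<noteq> i"
    using l assms(10) by auto
  ultimately show ?thesis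
    using \<open>l \<in> V\<close> by (intro bexI[of _ l] conjI)
qed

end
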